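(* Let $K\ge k\ge 2$ and let $\delta$ be a $k$-edge state on $\mathcal{A}(\mathbb{C}^{2K}\otimes\mathbb{C}^{2K})$. Let $C$ be an arbitrary positive (semidefinite) operator on $\mathcal{A}(\mathbb{C}^{2K}\otimes\mathbb{C}^{2K})$ with $\mathrm{Tr}(\delta C)>0$, and let $P$ be a positive (semidefinite) operator on $\mathcal{A}(\mathbb{C}^{2K}\otimes\mathbb{C}^{2K})$ whose range equals the kernel of $\delta$. Define $$\epsilon=\inf_{|\psi^{<k}\rangle}\langle\psi^{<k}|P|\psi^{<k}\rangle,\qquad c=\sup_{|\psi\rangle}\langle\psi|C|\psi\rangle,$$ where the infimum is over all normalized vectors $|\psi^{<k}\rangle\in\mathcal{A}(\mathbb{C}^{2K}\otimes\mathbb{C}^{2K})$ of Slater rank smaller than $k$ and the supremum is over all normalized vectors $|\psi\rangle\in\mathcal{A}(\mathbb{C}^{2K}\otimes\mathbb{C}^{2K})$. Then $$W=P-\frac{\epsilon}{c}\,C$$ is a $k$-Slater witness which detects $\delta$, i.e. $\mathrm{Tr}(W\delta)<0$.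
   Context: $\mathcal{A}(\mathbb{C}^{2K}\otimes\mathbb{C}^{2K})$ is the antisymmetric subspace (two fermions with single-particle space $\mathbb{C}^{2K}$). Slater rank: every unit vector in it can be written as $\sum_{i=1}^{K}z_i\,\frac{1}{\sqrt2}(u_i\otimes v_i-v_i\otimes u_i)$ with $u_1,v_1,\dots,u_K,v_K$ an orthonormal basis of $\mathbb{C}^{2K}$; the number of nonzero $z_i$ is its Slater rank. Slater number of a density matrix $\rho$: the minimum over all convex decompositions of $\rho$ into pure states of the maximal Slater rank occurring in the decomposition. $Sl_k$ is the set of density matrices on $\mathcal{A}(\mathbb{C}^{2K}\otimes\mathbb{C}^{2K})$ with Slater number at most $k$. A $k$-edge state is a density matrix $\delta$ such that $\delta-\varepsilon|\psi\rangle\langle\psi|$ is not positive semidefinite for any $\varepsilon>0$ and any pure state $|\psi\rangle$ of Slater rank smaller than $k$. A Hermitian operator $W$ on $\mathcal{A}(\mathbb{C}^{2K}\otimes\mathbb{C}^{2K})$ is a Slater witness of class $k$ ($k$-Slater witness, $k\ge2$) iff $\mathrm{Tr}(W\sigma)\ge0$ for all $\sigma\in Sl_{k-1}$ and there exists at least one $\rho\in Sl_k$ with $\mathrm{Tr}(W\rho)<0$.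
   Formalization: That W is a k-Slater witness is concluded only when δ has Slater number at most k; otherwise no state in Sl_k need be detected and the claim can fail. That W is Hermitian, Tr(Wσ)≥0 on Sl_{k-1}, and Tr(Wδ)<0 are proved for every k-edge state. *)

theory Defs
  imports "HOL-Analysis.Analysis" "HOL-Library.Extended_Nat"
begin

text \<open>
  With \<open>K = CARD('k)\<close>, the index type \<open>'k + 'k\<close> has \<open>2 * K\<close> elements, so \<open>'k orbital\<close> is the
  single-particle space of dimension \<open>2 * K\<close> and \<open>'k two_particle\<close> is its tensor square, with
  coordinates indexed by pairs of modes. The library norm on these types is the Hilbert space norm.
\<close>

type_synonym 'k orbital = "complex ^ ('k + 'k)"
type_synonym 'k two_particle = "complex ^ (('k + 'k) \<times> ('k + 'k))"
type_synonym 'k two_particle_op = "complex ^ (('k + 'k) \<times> ('k + 'k)) ^ (('k + 'k) \<times> ('k + 'k))"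

definition cinner :: "complex ^ 'n::finite \<Rightarrow> complex ^ 'n \<Rightarrow> complex" where
  "cinner x y = (\<Sum>i\<in>UNIV. cnj (x $ i) * y $ i)"

definition tensor :: "complex ^ 'n::finite \<Rightarrow> complex ^ 'n \<Rightarrow> complex ^ ('n \<times> 'n)" where
  "tensor u v = (\<chi> p. u $ fst p * v $ snd p)"

definition asym_space :: "'k::finite two_particle set" where
  "asym_space = {\<psi>. \<forall>i j. \<psi> $ (i, j) = - \<psi> $ (j, i)}"

definition pure_state :: "'k::finite two_particle \<Rightarrow> bool" where
  "pure_state \<psi> \<longleftrightarrow> \<psi> \<in> asym_space \<and> norm \<psi> = 1"

definition proj :: "complex ^ 'n::finite \<Rightarrow> complex ^ 'n ^ 'n" where
  "proj \<psi> = (\<chi> i j. \<psi> $ i * cnj (\<psi> $ j))"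

text \<open>
  An operator on the antisymmetric space is represented by its extension by zero to the whole
  tensor square; traces, Hermiticity and positivity are the same for both.
\<close>

definition op_on_asym :: "'k::finite two_particle_op \<Rightarrow> bool" where
  "op_on_asym X \<longleftrightarrow>
     (\<forall>\<psi>. X *v \<psi> \<in> asym_space) \<and>
     (\<forall>\<psi>. (\<forall>\<phi>\<in>asym_space. cinner \<phi> \<psi> = 0) \<longrightarrow> X *v \<psi> = 0)"

definition hermitian :: "complex ^ 'n::finite ^ 'n \<Rightarrow> bool" where
  "hermitian X \<longleftrightarrow> (\<forall>i j. X $ i $ j = cnj (X $ j $ i))"

definition psd :: "complex ^ 'n::finite ^ 'n \<Rightarrow> bool" where
  "psd X \<longleftrightarrow> hermitian X \<and> (\<forall>\<psi>. 0 \<le> Re (cinner \<psi> (X *v \<psi>)))"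

definition density :: "'k::finite two_particle_op \<Rightarrow> bool" where
  "density \<rho> \<longleftrightarrow> op_on_asym \<rho> \<and> psd \<rho> \<and> trace \<rho> = 1"

text \<open>An orthonormal family indexed by the coordinate type itself is automatically a basis.\<close>

definition orthonormal_basis :: "('n::finite \<Rightarrow> complex ^ 'n) \<Rightarrow> bool" where
  "orthonormal_basis b \<longleftrightarrow> (\<forall>i j. cinner (b i) (b j) = (if i = j then 1 else 0))"

definition slater_det :: "complex ^ 'n::finite \<Rightarrow> complex ^ 'n \<Rightarrow> complex ^ ('n \<times> 'n)" where
  "slater_det u v = (1 / sqrt 2) *\<^sub>R (tensor u v - tensor v u)"

text \<open>The basis vectors \<open>u i\<close>, \<open>v i\<close> of a Slater expansion are \<open>b (Inl i)\<close>, \<open>b (Inr i)\<close>.\<close>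

definition slater_expansion ::
  "'k::finite two_particle \<Rightarrow> ('k \<Rightarrow> complex) \<Rightarrow> ('k + 'k \<Rightarrow> 'k orbital) \<Rightarrow> bool" where
  "slater_expansion \<psi> z b \<longleftrightarrow>
     orthonormal_basis b \<and> \<psi> = (\<Sum>i\<in>UNIV. z i *s slater_det (b (Inl i)) (b (Inr i)))"

text \<open>
  Every Slater expansion of \<open>\<psi>\<close> has the same number of nonzero coefficients (half the rank of the
  coefficient matrix of \<open>\<psi>\<close>), so the infimum merely selects this common value.
\<close>

definition slater_rank :: "'k::finite two_particle \<Rightarrow> enat" where
  "slater_rank \<psi> = (INF (z, b) \<in> {(z, b). slater_expansion \<psi> z b}. enat (card {i. z i \<noteq> 0}))"

text \<open>All weights are positive, so that exactly the states that occur contribute to the maximum.\<close>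

definition pure_decomposition ::
  "'k::finite two_particle_op \<Rightarrow> nat \<Rightarrow> (nat \<Rightarrow> real) \<Rightarrow> (nat \<Rightarrow> 'k two_particle) \<Rightarrow> bool" where
  "pure_decomposition \<rho> n p \<psi> \<longleftrightarrow>
     (\<forall>i<n. 0 < p i \<and> pure_state (\<psi> i)) \<and> (\<Sum>i<n. p i) = 1 \<and>
     \<rho> = (\<Sum>i<n. p i *\<^sub>R proj (\<psi> i))"

definition slater_number :: "'k::finite two_particle_op \<Rightarrow> enat" where
  "slater_number \<rho> =
     (INF (n, p, \<psi>) \<in> {(n, p, \<psi>). pure_decomposition \<rho> n p \<psi>}. SUP i\<in>{..<n}. slater_rank (\<psi> i))"

definition Sl :: "nat \<Rightarrow> 'k::finite two_particle_op set" where
  "Sl k = {\<rho>. density \<rho> \<and> slater_number \<rho> \<le> enat k}"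

definition edge_state :: "nat \<Rightarrow> 'k::finite two_particle_op \<Rightarrow> bool" where
  "edge_state k \<delta> \<longleftrightarrow>
     density \<delta> \<and>
     (\<forall>e>0. \<forall>\<psi>. pure_state \<psi> \<and> slater_rank \<psi> < enat k \<longrightarrow> \<not> psd (\<delta> - e *\<^sub>R proj \<psi>))"

text \<open>The trace of a product of two Hermitian operators is real; \<open>Re\<close> only adjusts the type.\<close>

definition slater_witness :: "nat \<Rightarrow> 'k::finite two_particle_op \<Rightarrow> bool" where
  "slater_witness k W \<longleftrightarrow>
     2 \<le> k \<and> op_on_asym W \<and> hermitian W \<and>
     (\<forall>\<sigma>\<in>Sl (k - 1). 0 \<le> Re (trace (W ** \<sigma>))) \<and>
     (\<exists>\<rho>\<in>Sl k. Re (trace (W ** \<rho>)) < 0)"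

end

theory Submission
  imports Defs
begin

text \<open>
  The states of Slater rank below \<open>k\<close> form a compact set, so \<open>\<epsilon>\<close> is attained. If it were \<open>0\<close>,
  a minimizer \<open>\<psi>\<close> would satisfy \<open>P \<psi> = 0\<close>; then \<open>\<psi>\<close> is orthogonal to the range of \<open>P\<close>, i.e. to the
  kernel of \<open>\<delta>\<close>, hence \<open>\<psi> = \<delta> \<chi>\<close> for some \<open>\<chi>\<close>, and by Cauchy--Schwarz for the form of \<open>\<delta>\<close> a small multiple of
  \<open>|\<psi>\<rangle>\<langle>\<psi>|\<close> can be subtracted from \<open>\<delta>\<close>, against the edge property. With \<open>\<epsilon>, c > 0\<close>, the bound
  \<open>\<langle>\<psi>|W|\<psi>\<rangle> \<ge> \<epsilon> - (\<epsilon> / c) c = 0\<close> holds on these states, while \<open>\<delta> P = 0\<close> leaves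
  \<open>Tr (W \<delta>) = - (\<epsilon> / c) Tr (\<delta> C) < 0\<close>.
\<close>

section \<open>The Hermitian inner product\<close>

lemma Re_cinner: "Re (cinner x y) = inner x y"
  by (simp add: cinner_def inner_vec_def inner_complex_def)

lemma cinner_commute: "cinner x y = cnj (cinner y x)"
  by (simp add: cinner_def mult.commute)

lemma cinner_self: "cinner x x = of_real ((norm x)\<^sup>2)"
proof -
  have "Im (cinner x x) = 0"
    by (simp add: cinner_def)
  then show ?thesis
    by (simp add: complex_eq_iff Re_cinner power2_norm_eq_inner)
qed

lemma cinner_add_right: "cinner x (y + z) = cinner x y + cinner x z"
  by (simp add: cinner_def distrib_left sum.distrib)

lemma cinner_diff_right: "cinner x (y - z) = cinner x y - cinner x z"
  by (simp add: cinner_def right_diff_distrib sum_subtractf)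

lemma cinner_scale_right: "cinner x (a *s y) = a * cinner x y"
  by (simp add: cinner_def sum_distrib_left mult_ac)

lemma cinner_scale_left: "cinner (a *s x) y = cnj a * cinner x y"
  by (simp add: cinner_def sum_distrib_left mult_ac)

lemma cinner_scaleR_right: "cinner x (r *\<^sub>R y) = of_real r * cinner x y"
  by (simp add: cinner_def scaleR_sum_right flip: scaleR_conv_of_real)

lemma cinner_sum_right: "cinner x (sum f A) = (\<Sum>a\<in>A. cinner x (f a))"
  unfolding cinner_def by (subst sum.swap) (simp add: sum_distrib_left)

lemma cinner_tensor: "cinner (tensor u v) (tensor u' v') = cinner u u' * cinner v v'"
proof -
  have "cinner (tensor u v) (tensor u' v') =
      (\<Sum>(i, j)\<in>UNIV \<times> UNIV. (cnj (u $ i) * u' $ i) * (cnj (v $ j) * v' $ j))"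
    by (simp add: cinner_def tensor_def case_prod_unfold mult_ac)
  also have "\<dots> = cinner u u' * cinner v v'"
    by (simp only: sum.cartesian_product[symmetric] cinner_def sum_product)
  finally show ?thesis .
qed

lemma scaleR_mult_vector: "(r *\<^sub>R A) *v x = r *\<^sub>R (A *v (x :: complex ^ 'n))"
  by (simp add: vec_eq_iff matrix_vector_mult_def scaleR_sum_right)

lemma mult_scaleR_vector: "A *v (r *\<^sub>R x) = r *\<^sub>R (A *v (x :: complex ^ 'n))"
  by (rule linear_scale[OF matrix_vector_mul_linear])

lemma proj_mult_vector: "proj \<psi> *v x = cinner \<psi> x *s \<psi>"
  by (simp add: vec_eq_iff matrix_vector_mult_def proj_def cinner_def sum_distrib_left mult_ac)

lemma trace_mult_proj: "trace (A ** proj \<psi>) = cinner \<psi> (A *v \<psi>)"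
  by (simp add: trace_def matrix_matrix_mult_def proj_def cinner_def matrix_vector_mult_def
      sum_distrib_left mult_ac)

text \<open>Serves both for mixtures of pure states and for splitting \<open>W\<close> into its
  \<open>P\<close> and \<open>C\<close> terms.\<close>

lemma trace_mult_sum:
  fixes A :: "complex ^ 'n ^ 'n"
  shows "trace (A ** (\<Sum>i\<in>I. p i *\<^sub>R B i)) = (\<Sum>i\<in>I. of_real (p i) * trace (A ** B i))"
proof -
  have add: "trace (A ** (X + Y)) = trace (A ** X) + trace (A ** Y)" for X Y
    by (simp add: matrix_add_ldistrib trace_add)
  have scale: "trace (A ** (r *\<^sub>R X)) = of_real r * trace (A ** X)" for r X
    by (simp add: trace_def matrix_matrix_mult_def scaleR_sum_right flip: scaleR_conv_of_real)
  have zero: "trace (0 :: complex ^ 'n ^ 'n) = 0"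
    by (simp add: trace_def)
  show ?thesis
    by (induction I rule: infinite_finite_induct) (simp_all add: add scale zero)
qed

section \<open>Positive semidefinite operators\<close>

lemma hermitian_cnj: "hermitian A \<Longrightarrow> cnj (A $ j $ i) = A $ i $ j"
  unfolding hermitian_def by metis

lemma hermitian_cinner:
  assumes "hermitian A"
  shows "cinner x (A *v y) = cinner (A *v x) y"
proof -
  have "cinner x (A *v y) = (\<Sum>i\<in>UNIV. \<Sum>j\<in>UNIV. A $ i $ j * cnj (x $ i) * y $ j)"
    by (simp add: cinner_def matrix_vector_mult_def sum_distrib_left mult_ac)
  also have "\<dots> = (\<Sum>j\<in>UNIV. \<Sum>i\<in>UNIV. A $ i $ j * cnj (x $ i) * y $ j)"
    by (rule sum.swap)
  also have "\<dots> = cinner (A *v x) y"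
    by (simp add: cinner_def matrix_vector_mult_def sum_distrib_right hermitian_cnj[OF assms])
  finally show ?thesis .
qed

lemma hermitian_diff_scaleR:
  assumes "hermitian A" "hermitian B"
  shows "hermitian (A - r *\<^sub>R B)"
  using hermitian_cnj[OF assms(1)] hermitian_cnj[OF assms(2)] by (simp add: hermitian_def)

lemma hermitian_proj: "hermitian (proj \<psi>)"
  by (simp add: hermitian_def proj_def)

text \<open>The quadratic form is nonnegative along the real line \<open>x + t y\<close>, which
  bounds its discriminant. The pairing here is only the real part of the Hermitian one; complex
  phases are dealt with where the lemma is applied.\<close>

lemma psd_cauchy_schwarz:
  assumes "psd A"
  shows "(inner x (A *v y))\<^sup>2 \<le> inner x (A *v x) * inner y (A *v y)"
proof -
  have herm: "hermitian A" and nonneg: "\<And>z. 0 \<le> inner z (A *v z)"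
    using assms by (auto simp: psd_def Re_cinner)
  have sym: "inner y (A *v x) = inner x (A *v y)"
    by (metis herm hermitian_cinner Re_cinner inner_commute)
  define a b d where "a = inner x (A *v x)" and "b = inner x (A *v y)" and "d = inner y (A *v y)"
  have quad: "0 \<le> a + 2 * t * b + t\<^sup>2 * d" for t
  proof -
    have "A *v (x + t *\<^sub>R y) = A *v x + t *\<^sub>R (A *v y)"
      by (simp add: matrix_vector_right_distrib mult_scaleR_vector)
    then have "inner (x + t *\<^sub>R y) (A *v (x + t *\<^sub>R y)) = a + 2 * t * b + t\<^sup>2 * d"
      using sym by (simp add: a_def b_def d_def inner_add_left inner_add_right algebra_simps power2_eq_square)
    with nonneg show ?thesis by metis
  qed
  have "b\<^sup>2 \<le> a * d"
  proof (cases "d = 0")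
    case True
    have "b = 0"
    proof (rule ccontr)
      \<comment> \<open>With d = 0 the quadratic is affine in t; this t gives it the value
        -1.\<close>
      assume "b \<noteq> 0"
      then have "2 * (- (a + 1) / (2 * b)) * b = - (a + 1)" by simp
      with quad[of "- (a + 1) / (2 * b)"] True show False
        by (simp only: mult_zero_right add_0_right)
    qed
    then show ?thesis using True by simp
  next
    case False
    then have "d > 0" using nonneg[of y] by (simp add: d_def)
    \<comment> \<open>The minimizing t.\<close>
    with quad[of "- b / d"] show ?thesis
      by (simp add: field_simps power2_eq_square)
  qed
  then show ?thesis by (simp add: a_def b_def d_def)
qed

text \<open>Cauchy-Schwarz applied to \<open>A *v x\<close> and \<open>x\<close> bounds the fourth
  power of the norm of \<open>A *v x\<close> by a multiple of the vanishing expectation.\<close>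

lemma psd_zero_imp_kernel:
  assumes "psd A" "inner x (A *v x) = 0"
  shows "A *v x = 0"
proof -
  have "(inner (A *v x) (A *v x))\<^sup>2 \<le> 0"
    using psd_cauchy_schwarz[OF assms(1), of "A *v x" x] assms(2) by simp
  then show ?thesis by simp
qed

text \<open>A finite-dimensional subspace is its own double orthogonal complement. A vector y
  orthogonal to the range, tested against the image of \<open>A *v y\<close>, lies in the kernel,
  and the hypothesis then applies to it.\<close>

lemma hermitian_range:
  fixes A :: "complex ^ 'n ^ 'n"
  assumes "hermitian A" and orth: "\<And>y. A *v y = 0 \<Longrightarrow> inner x y = 0"
  shows "x \<in> range ((*v) A)"
proof -
  have sub: "subspace (range ((*v) A))"
    by (rule linear_subspace_image[OF matrix_vector_mul_linear subspace_UNIV])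
  have "x \<in> (range ((*v) A))\<^sup>\<bottom>\<^sup>\<bottom>"
  proof (clarsimp simp: orthogonal_comp_def orthogonal_def)
    fix y assume y: "\<forall>z. inner (A *v z) y = 0"
    have "inner (A *v y) (A *v y) = 0"
      using y by (metis Re_cinner assms(1) hermitian_cinner)
    then show "inner y x = 0"
      using orth[of y] by (simp add: inner_commute)
  qed
  then show ?thesis
    using orthogonal_comp_self[OF sub] by simp
qed

text \<open>With q = <y, A y>, Cauchy-Schwarz gives |<A y, x>|^2 \<le> q <x, A x> for all x, so any
  positive e with e q \<le> 1 works.\<close>

lemma psd_minus_proj_range:
  assumes "psd A"
  shows "\<exists>e>0. psd (A - e *\<^sub>R proj (A *v y))"
proof -
  define q where "q = inner y (A *v y)"
  have herm: "hermitian A" and nonneg: "\<And>z. 0 \<le> inner z (A *v z)"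
    using assms by (auto simp: psd_def Re_cinner)
  have q: "0 \<le> q" using nonneg by (simp add: q_def)
  \<comment> \<open>The summand 1 keeps e well defined and positive when q = 0.\<close>
  define e where "e = 1 / (q + 1)"
  have e: "0 < e" "e * q \<le> 1" using q by (simp_all add: e_def field_simps)
  have "0 \<le> inner x ((A - e *\<^sub>R proj (A *v y)) *v x)" for x
  proof -
    define s where "s = cinner (A *v y) x"
    define m where "m = (cmod s)\<^sup>2"
    have s2: "cnj s * s = of_real m"
      by (simp only: m_def complex_norm_square mult.commute)
    \<comment> \<open>Scaling x by \<open>cnj s\<close> makes <y, A w> equal to the real number m =
      |s|^2, so the real Cauchy-Schwarz inequality controls the full modulus. The extra factor m is
      cancelled afterwards.\<close>
    define w where "w = cnj s *s x"
    have Aw: "A *v w = cnj s *s (A *v x)"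
      by (simp add: w_def vector_scalar_commute)
    have "inner y (A *v w) = m"
    proof -
      have "cinner y (A *v w) = cnj s * cinner y (A *v x)"
        by (simp add: Aw cinner_scale_right)
      also have "\<dots> = of_real m"
        using hermitian_cinner[OF herm, of y x] s2 by (simp add: s_def)
      finally show ?thesis by (metis Re_cinner Re_complex_of_real)
    qed
    moreover have "inner w (A *v w) = m * inner x (A *v x)"
    proof -
      have "cinner w (A *v w) = of_real m * cinner x (A *v x)"
        unfolding s2[symmetric]
        by (simp only: w_def vector_scalar_commute cinner_scale_right cinner_scale_left complex_cnj_cnj mult_ac)
      then show ?thesis by (simp add: Re_cinner[symmetric])
    qed
    ultimately have "m\<^sup>2 \<le> q * (m * inner x (A *v x))"
      using psd_cauchy_schwarz[OF assms, of y w] by (simp add: q_def)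
    then have mq: "m \<le> q * inner x (A *v x)"
    proof (cases "m = 0")
      case False
      then have "m > 0" by (simp add: m_def)
      with \<open>m\<^sup>2 \<le> _\<close> show ?thesis
        by (simp add: power2_eq_square mult.left_commute)
    qed (use q nonneg in simp)
    have "e * m \<le> (e * q) * inner x (A *v x)"
      using mq e(1) by simp
    also have "\<dots> \<le> inner x (A *v x)"
      using e(2) nonneg[of x] mult_right_mono by fastforce
    finally have le: "e * m \<le> inner x (A *v x)" .
    have "cinner x (proj (A *v y) *v x) = of_real m"
      using s2 cinner_commute[of x "A *v y"]
      by (simp add: proj_mult_vector cinner_scale_right s_def mult.commute)
    then have "inner x (proj (A *v y) *v x) = m"
      by (metis Re_cinner Re_complex_of_real)
    then show ?thesis
      using le by (simp add: matrix_vector_mult_diff_rdistrib scaleR_mult_vector inner_diff_right)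
  qed
  then have "psd (A - e *\<^sub>R proj (A *v y))"
    using hermitian_diff_scaleR[OF herm hermitian_proj] by (simp add: psd_def Re_cinner)
  with e show ?thesis by blast
qed

section \<open>The antisymmetric subspace\<close>

lemma asym_spaceD: "\<phi> \<in> asym_space \<Longrightarrow> \<phi> $ (i, j) = - \<phi> $ (j, i)"
  unfolding asym_space_def by blast

text \<open>Exchanging the two particles in the sum flips its sign, so it equals its own
  negative.\<close>

lemma cinner_asym_sym:
  assumes "\<phi> \<in> asym_space" "\<And>i j. s $ (i, j) = s $ (j, i)"
  shows "cinner \<phi> s = 0"
proof -
  have "cinner \<phi> s = (\<Sum>p\<in>UNIV. cnj (\<phi> $ prod.swap p) * s $ prod.swap p)"
    unfolding cinner_def
    by (rule sum.reindex_bij_betw[symmetric]) (simp add: bij_swap)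
  also have "\<dots> = (\<Sum>p\<in>UNIV. - (cnj (\<phi> $ p) * s $ p))"
  proof (rule sum.cong)
    fix p :: "('a + 'a) \<times> ('a + 'a)"
    obtain i j where p: "p = (i, j)" by fastforce
    from assms(2)[of i j] asym_spaceD[OF assms(1), of j i] show "cnj (\<phi> $ prod.swap p) * s $ prod.swap p = - (cnj (\<phi> $ p) * s $ p)"
      by (simp add: p)
  qed simp
  also have "\<dots> = - cinner \<phi> s"
    by (simp add: cinner_def sum_negf)
  finally show ?thesis by simp
qed

text \<open>The parts are half the difference and half the sum of x and its particle swap. The
  symmetric part is described by orthogonality because \<open>op_on_asym\<close> annihilates vectors
  in that form.\<close>

lemma asym_decomposition:
  fixes x :: "'k::finite two_particle"
  obtains a s where "x = a + s" "a \<in> asym_space" "\<And>\<phi>. \<phi> \<in> asym_space \<Longrightarrow> cinner \<phi> s = 0"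
proof
  let ?t = "\<chi> p. x $ prod.swap p"
  show "x = (1/2) *\<^sub>R (x - ?t) + (1/2) *\<^sub>R (x + ?t)"
    by (simp add: vec_eq_iff algebra_simps flip: scaleR_left.add)
  show "(1/2) *\<^sub>R (x - ?t) \<in> asym_space"
    by (simp add: asym_space_def flip: scaleR_minus_right)
  show "cinner \<phi> ((1/2) *\<^sub>R (x + ?t)) = 0" if "\<phi> \<in> asym_space" for \<phi>
    using that by (rule cinner_asym_sym) (simp add: add.commute)
qed

text \<open>Operators extended by zero are determined on antisymmetric vectors. Taking B to be the
  identity shows X = 0; taking B = \<delta> yields \<open>\<delta> ** P = 0\<close>.\<close>

lemma op_on_asym_eq_zero:
  assumes "op_on_asym X" "\<And>a. a \<in> asym_space \<Longrightarrow> B *v (X *v a) = 0"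
  shows "B ** X = 0"
proof -
  have "(B ** X) *v x = 0" for x
  proof -
    obtain a s where x: "x = a + s" "a \<in> asym_space" "\<And>\<phi>. \<phi> \<in> asym_space \<Longrightarrow> cinner \<phi> s = 0"
      using asym_decomposition by blast
    then have "X *v s = 0" using assms(1) by (simp add: op_on_asym_def)
    then have "X *v x = X *v a" by (simp add: x(1) matrix_vector_right_distrib)
    then show ?thesis using assms(2)[OF x(2)] by (simp add: matrix_vector_mul_assoc[symmetric])
  qed
  then show ?thesis by (simp add: matrix_eq)
qed

lemma subspace_asym_space: "subspace asym_space"
proof (rule subspaceI)
  fix x y :: "'a two_particle" and r :: real
  assume x: "x \<in> asym_space"
  have "(r *\<^sub>R x) $ (i, j) = - (r *\<^sub>R x) $ (j, i)" for i j
    using asym_spaceD[OF x, of i j] by simp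
  then show "r *\<^sub>R x \<in> asym_space"
    unfolding asym_space_def by blast
  assume y: "y \<in> asym_space"
  have "(x + y) $ (i, j) = - (x + y) $ (j, i)" for i j
    using asym_spaceD[OF x, of i j] asym_spaceD[OF y, of i j] by simp
  then show "x + y \<in> asym_space"
    unfolding asym_space_def by blast
qed (simp add: asym_space_def)

lemma closed_asym_space: "closed asym_space"
  by (rule closed_subspace[OF subspace_asym_space])

lemma asym_scale:
  assumes "x \<in> asym_space"
  shows "a *s x \<in> asym_space"
proof -
  have "(a *s x) $ (i, j) = - (a *s x) $ (j, i)" for i j
    using asym_spaceD[OF assms, of i j] by simp
  then show ?thesis
    unfolding asym_space_def by blast
qed

lemma op_on_asym_diff_scaleR:
  assumes "op_on_asym A" "op_on_asym B"
  shows "op_on_asym (A - r *\<^sub>R B)"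
  using assms unfolding op_on_asym_def matrix_vector_mult_diff_rdistrib scaleR_mult_vector
  by (simp add: subspace_diff[OF subspace_asym_space] subspace_scale[OF subspace_asym_space])

lemma compact_pure_states: "compact {\<psi>. pure_state \<psi>}"
proof -
  have "{\<psi>. pure_state \<psi>} = asym_space \<inter> sphere 0 1"
    by (auto simp: pure_state_def)
  then show ?thesis
    by (metis closed_Int_compact closed_asym_space compact_sphere)
qed

lemma continuous_expectation:
  "continuous_on S (\<lambda>\<psi>. Re (cinner \<psi> (A *v \<psi>)))"
  unfolding cinner_def matrix_vector_mult_def by (simp, intro continuous_intros)

text \<open>Compactness of the unit sphere bounds the expectations, without which a real
  \<open>SUP\<close> need not be an upper bound.\<close>

lemma expectation_le_Sup:
  assumes "pure_state \<psi>"
  shows "Re (cinner \<psi> (A *v \<psi>)) \<le> (SUP \<psi>\<in>{\<psi>. pure_state \<psi>}. Re (cinner \<psi> (A *v \<psi>)))"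
proof (rule cSUP_upper)
  show "bdd_above ((\<lambda>\<psi>. Re (cinner \<psi> (A *v \<psi>))) ` {\<psi>. pure_state \<psi>})"
    by (intro bounded_imp_bdd_above compact_imp_bounded compact_continuous_image
        continuous_expectation compact_pure_states)
qed (use assms in simp)

text \<open>If the supremum were not positive, all expectations would vanish, so A would kill every
  antisymmetric vector. This makes the division by c legitimate.\<close>

lemma psd_Sup_expectation_pos:
  assumes op: "op_on_asym A" and A: "psd A" and nz: "A \<noteq> 0"
  shows "0 < (SUP \<psi>\<in>{\<psi>. pure_state \<psi>}. Re (cinner \<psi> (A *v \<psi>)))" (is "0 < ?c")
proof (rule ccontr)
  assume c: "\<not> 0 < ?c"
  have "A *v x = 0" if x: "x \<in> asym_space" for x
  proof (cases "x = 0")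
    case False
    define y where "y = (1 / norm x) *\<^sub>R x"
    have y: "pure_state y"
      using x False subspace_scale[OF subspace_asym_space] by (simp add: y_def pure_state_def)
    have "inner y (A *v y) = 0"
      using A expectation_le_Sup[OF y, of A] c
      by (smt (verit) Re_cinner psd_def)
    then have "A *v y = 0" using A by (rule psd_zero_imp_kernel[rotated])
    moreover have "A *v y = (1 / norm x) *\<^sub>R (A *v x)"
      by (simp add: y_def mult_scaleR_vector)
    ultimately show ?thesis using False by simp
  qed simp
  then have "mat 1 ** A = 0"
    by (intro op_on_asym_eq_zero[OF op]) simp
  then show False using nz by simp
qed

section \<open>Vectors of bounded Slater rank\<close>

lemma slater_det_asym: "slater_det u v \<in> asym_space"
  by (simp add: slater_det_def asym_space_def tensor_def algebra_simps)

text \<open>The four tensor products agree in pairs, and the resulting factor 2 cancels the two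
  normalizations.\<close>

lemma cinner_slater_det:
  "cinner (slater_det u v) (slater_det u' v') = cinner u u' * cinner v v' - cinner u v' * cinner v u'"
proof -
  have sq: "complex_of_real (sqrt 2) * complex_of_real (sqrt 2) = 2"
    by (simp flip: of_real_mult)
  have left: "cinner (r *\<^sub>R (x - y)) z = of_real r * (cinner x z - cinner y z)"
    for r and x y z :: "complex ^ 'm"
    by (subst (1 2 3) cinner_commute) (simp add: cinner_scaleR_right cinner_diff_right)
  show ?thesis
    unfolding slater_det_def
    by (simp add: cinner_scaleR_right cinner_diff_right left cinner_tensor)
      (simp add: field_simps sq)
qed

lemma cinner_slater_det_basis:
  assumes "orthonormal_basis b"
  shows "cinner (slater_det (b (Inl i)) (b (Inr i))) (slater_det (b (Inl j)) (b (Inr j))) = (if i = j then 1 else 0)"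
  using assms by (simp add: orthonormal_basis_def cinner_slater_det)

text \<open>Parseval for the orthonormal determinants of the paired basis; it carries normalization
  between \<psi> and its coefficients.\<close>

lemma norm_slater_expansion:
  assumes "slater_expansion \<psi> z b"
  shows "(norm \<psi>)\<^sup>2 = (\<Sum>i\<in>UNIV. (cmod (z i))\<^sup>2)"
proof -
  let ?s = "\<lambda>i. slater_det (b (Inl i)) (b (Inr i))"
  have b: "orthonormal_basis b" and \<psi>: "\<psi> = (\<Sum>i\<in>UNIV. z i *s ?s i)"
    using assms by (auto simp: slater_expansion_def)
  have coeff: "cinner (?s i) \<psi> = z i" for i
    unfolding \<psi> cinner_sum_right
    by (simp add: cinner_scale_right cinner_slater_det_basis[OF b] if_distrib cong: if_cong)
  have "cinner \<psi> \<psi> = (\<Sum>i\<in>UNIV. z i * cinner \<psi> (?s i))"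
    by (subst (2) \<psi>) (simp add: cinner_sum_right cinner_scale_right)
  also have "\<dots> = (\<Sum>i\<in>UNIV. of_real ((cmod (z i))\<^sup>2))"
    by (subst cinner_commute) (simp add: coeff complex_norm_square del: of_real_power)
  finally show ?thesis
    by (simp add: cinner_self flip: of_real_sum) (simp flip: of_real_power of_real_sum)
qed

lemma slater_rank_less_iff:
  "slater_rank \<psi> < enat k \<longleftrightarrow> (\<exists>z b. slater_expansion \<psi> z b \<and> card {i. z i \<noteq> 0} < k)"
  by (auto simp: slater_rank_def INF_less_iff)

lemma slater_expansion_asym:
  "slater_expansion \<psi> z b \<Longrightarrow> \<psi> \<in> asym_space"
  by (auto simp: slater_expansion_def intro!: subspace_sum[OF subspace_asym_space] asym_scale slater_det_asym)

lemma orthonormal_basis_axis: "orthonormal_basis (\<lambda>i. axis i 1)"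
proof -
  have "cnj (axis i 1 $ l) * axis j 1 $ l = (if l = i then if i = j then 1 else 0 else 0)" for i j l :: 'a
    by (simp add: axis_def)
  then show ?thesis by (simp add: orthonormal_basis_def cinner_def)
qed

text \<open>One determinant of standard basis vectors; it makes the set over which \<epsilon> is
  minimized nonempty.\<close>

lemma exists_pure_slater_rank_less:
  assumes "2 \<le> k"
  shows "\<exists>\<psi> :: 'k::finite two_particle. pure_state \<psi> \<and> slater_rank \<psi> < enat k"
proof -
  \<comment> \<open>\<open>undefined\<close> is just some fixed index, so the support has size 1 <
    k.\<close>
  define z :: "'k \<Rightarrow> complex" where "z i = (if i = undefined then 1 else 0)" for i
  define b :: "'k + 'k \<Rightarrow> 'k orbital" where "b i = axis i 1" for i
  define \<psi> where "\<psi> = (\<Sum>i\<in>UNIV. z i *s slater_det (b (Inl i)) (b (Inr i)))"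
  have exp: "slater_expansion \<psi> z b"
    using orthonormal_basis_axis by (simp add: slater_expansion_def \<psi>_def b_def[abs_def])
  have "(norm \<psi>)\<^sup>2 = 1"
    by (simp add: norm_slater_expansion[OF exp] z_def if_distrib[of cmod] if_distrib[of "\<lambda>x. x\<^sup>2"] cong: if_cong)
  then have "pure_state \<psi>"
    using slater_expansion_asym[OF exp] by (simp add: pure_state_def power2_eq_1_iff)
      (smt (verit) norm_ge_zero)
  moreover have "card {i. z i \<noteq> 0} < k"
    using assms by (simp add: z_def)
  ultimately show ?thesis
    using exp slater_rank_less_iff by blast
qed

text \<open>Pure states of bounded Slater rank are the continuous image of the compact set of pairs of
  a unit coefficient vector with small support and a unitary matrix.\<close>

lemma compact_slater_rank_less:
  "compact {\<psi> :: 'k::finite two_particle. pure_state \<psi> \<and> slater_rank \<psi> < enat k}"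
proof -
  define Z where "Z = {z :: complex ^ 'k. norm z = 1 \<and> card {i. z $ i \<noteq> 0} < k}"
  define U where "U = {B :: complex ^ ('k + 'k) ^ ('k + 'k). orthonormal_basis (($) B)}"
  define F where "F = (\<lambda>(z :: complex ^ 'k, B :: complex ^ ('k + 'k) ^ ('k + 'k)).
    \<Sum>i\<in>UNIV. z $ i *s slater_det (B $ Inl i) (B $ Inr i))"
  have Z: "compact Z"
  proof -
    \<comment> \<open>Small support means lying in one of finitely many coordinate subspaces, which
      exhibits the condition as closed.\<close>
    have "Z = (\<Union>S\<in>{S. card S < k}. {z. \<forall>i. i \<notin> S \<longrightarrow> z $ i = 0}) \<inter> sphere 0 1"
    proof (intro equalityI subsetI)
      fix z :: "complex ^ 'k" assume "z \<in> (\<Union>S\<in>{S. card S < k}. {z. \<forall>i. i \<notin> S \<longrightarrow> z $ i = 0}) \<inter> sphere 0 1"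
      then obtain S where S: "card S < k" "\<forall>i. i \<notin> S \<longrightarrow> z $ i = 0" and z: "norm z = 1"
        by auto
      have "card {i. z $ i \<noteq> 0} \<le> card S"
        using S(2) by (intro card_mono) auto
      with S z show "z \<in> Z" by (simp add: Z_def)
    qed (auto simp: Z_def)
    moreover have "closed {z :: complex ^ 'k. \<forall>i. i \<notin> S \<longrightarrow> z $ i = 0}" for S
      by (intro closed_Collect_all closed_Collect_imp closed_Collect_eq continuous_intros) simp
    ultimately show ?thesis
      by (metis (no_types, lifting) closed_Int_compact closed_UN compact_sphere finite)
  qed
  have U: "compact U"
  proof -
    have "closed U"
      unfolding U_def orthonormal_basis_def cinner_def
      by (intro closed_Collect_all closed_Collect_eq continuous_intros)
    \<comment> \<open>The rows are unit vectors, and the norm of B is at most the sum of the row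
      norms.\<close>
    moreover have "norm B \<le> real CARD('k + 'k)" if "B \<in> U" for B
    proof -
      have "norm (B $ i) = 1" for i
      proof -
        have "cinner (B $ i) (B $ i) = 1"
          using that by (simp add: U_def orthonormal_basis_def)
        then have "inner (B $ i) (B $ i) = 1" by (metis Re_cinner one_complex.simps(1))
        then show ?thesis by (simp add: norm_eq_1)
      qed
      then show ?thesis
        using L2_set_le_sum[of UNIV "\<lambda>i. norm (B $ i)"] by (simp add: norm_vec_def)
    qed
    ultimately show ?thesis
      by (meson boundedI compact_eq_bounded_closed)
  qed
  have "continuous_on (Z \<times> U) F"
    unfolding F_def slater_det_def tensor_def vector_scalar_mult_def case_prod_unfold
    by (intro continuous_intros continuous_on_vec_lambda)
  then have "compact (F ` (Z \<times> U))"
    using Z U by (intro compact_continuous_image compact_Times)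
  moreover have "{\<psi>. pure_state \<psi> \<and> slater_rank \<psi> < enat k} = F ` (Z \<times> U)"
  proof (intro equalityI subsetI)
    fix \<psi> :: "'k two_particle" assume "\<psi> \<in> {\<psi>. pure_state \<psi> \<and> slater_rank \<psi> < enat k}"
    then obtain z b where \<psi>: "norm \<psi> = 1" and exp: "slater_expansion \<psi> z b" and card: "card {i. z i \<noteq> 0} < k"
      by (auto simp: pure_state_def slater_rank_less_iff)
    have "norm (vec_lambda z) = 1"
      using norm_slater_expansion[OF exp] \<psi> by (simp add: norm_vec_def L2_set_def)
    then have "(vec_lambda z, vec_lambda b) \<in> Z \<times> U"
      using card exp by (simp add: Z_def U_def slater_expansion_def vec_lambda_inverse)
    moreover have "\<psi> = F (vec_lambda z, vec_lambda b)"
      using exp by (simp add: F_def slater_expansion_def)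
    ultimately show "\<psi> \<in> F ` (Z \<times> U)" by blast
  next
    fix \<psi> assume "\<psi> \<in> F ` (Z \<times> U)"
    then obtain z B where z: "norm z = 1" "card {i. z $ i \<noteq> 0} < k" and exp: "slater_expansion \<psi> (($) z) (($) B)"
      by (auto simp: F_def Z_def U_def slater_expansion_def)
    have "norm \<psi> = 1"
      using norm_slater_expansion[OF exp] z(1)
      by (metis norm_vec_def L2_set_def norm_ge_zero real_sqrt_abs abs_of_nonneg)
    then show "\<psi> \<in> {\<psi>. pure_state \<psi> \<and> slater_rank \<psi> < enat k}"
      using z(2) exp slater_expansion_asym[OF exp] by (auto simp: pure_state_def slater_rank_less_iff)
  qed
  ultimately show ?thesis by simp
qed

section \<open>Edge states and their witnesses\<close>

lemma Sl_decomposition: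
  assumes "\<sigma> \<in> Sl k"
  obtains n p \<psi> where "pure_decomposition \<sigma> n p \<psi>" "\<And>i. i < n \<Longrightarrow> slater_rank (\<psi> i) \<le> enat k"
proof -
  \<comment> \<open>A strict bound on an infimum is met by an actual decomposition; since
    \<open>enat\<close> is discrete, each rank below \<open>Suc k\<close> is at most k.\<close>
  have "slater_number \<sigma> < enat (Suc k)"
    using assms by (simp add: Sl_def) (metis enat_ord_simps(2) le_less_trans lessI)
  then obtain n p \<psi> where d: "pure_decomposition \<sigma> n p \<psi>" and lt: "(SUP i\<in>{..<n}. slater_rank (\<psi> i)) < enat (Suc k)"
    by (auto simp: slater_number_def INF_less_iff)
  have "slater_rank (\<psi> i) \<le> enat k" if "i < n" for i
  proof -
    have "slater_rank (\<psi> i) < enat (Suc k)"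
      using that lt by (meson SUP_upper le_less_trans lessThan_iff)
    then show ?thesis by (cases "slater_rank (\<psi> i)") auto
  qed
  with d show thesis by (rule that)
qed

text \<open>The edge property enters the argument only here. Of the equality between range of P and
  kernel of \<delta>, this uses that the kernel lies in the range; the reverse inclusion later gives
  \<open>\<delta> ** P = 0\<close>.\<close>

lemma edge_state_no_kernel_vector:
  assumes edge: "edge_state k \<delta>"
    and P: "psd P"
    and range_P: "{\<psi> \<in> asym_space. \<delta> *v \<psi> = 0} \<subseteq> (\<lambda>\<psi>. P *v \<psi>) ` asym_space"
    and \<psi>: "pure_state \<psi>" "slater_rank \<psi> < enat k"
  shows "0 < Re (cinner \<psi> (P *v \<psi>))"
proof (rule ccontr)
  have \<delta>: "op_on_asym \<delta>" "psd \<delta>" using edge by (auto simp: edge_state_def density_def)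
  assume "\<not> ?thesis"
  then have "inner \<psi> (P *v \<psi>) = 0"
    using P by (smt (verit) Re_cinner psd_def)
  then have P\<psi>: "P *v \<psi> = 0" by (rule psd_zero_imp_kernel[OF P])
  \<comment> \<open>The kernel of the extended \<delta> also contains symmetric vectors, which P
    does not reach; they are orthogonal to \<psi> anyway, so only the antisymmetric part of y needs
    P.\<close>
  have "inner \<psi> y = 0" if y: "\<delta> *v y = 0" for y
  proof -
    obtain a s where d: "y = a + s" "a \<in> asym_space" "\<And>\<phi>. \<phi> \<in> asym_space \<Longrightarrow> cinner \<phi> s = 0"
      using asym_decomposition by blast
    then have "\<delta> *v s = 0" using \<delta>(1) by (simp add: op_on_asym_def)
    then have "\<delta> *v a = 0" using y by (simp add: d(1) matrix_vector_right_distrib)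
    then obtain x where x: "a = P *v x" using d(2) range_P by auto
    have "cinner \<psi> a = cinner (P *v \<psi>) x"
      using P by (simp add: x psd_def hermitian_cinner)
    also have "\<dots> = 0" by (simp add: P\<psi> cinner_def)
    finally have "cinner \<psi> y = 0"
      using d(3)[of \<psi>] \<psi>(1) by (simp add: d(1) cinner_add_right pure_state_def)
    then show ?thesis by (metis Re_cinner zero_complex.simps(1))
  qed
  then obtain x where "\<psi> = \<delta> *v x"
    using hermitian_range \<delta>(2) psd_def by blast
  then obtain e where "0 < e" "psd (\<delta> - e *\<^sub>R proj \<psi>)"
    using psd_minus_proj_range[OF \<delta>(2), of x] by auto
  with edge \<psi> show False by (auto simp: edge_state_def)
qed

text \<open>The edge property does not bound the Slater number from above: for k < K, a pure state
  of Slater rank k + 1 is a k-edge state. Nonnegativity on \<open>Sl (k - 1)\<close> and detection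
  of \<delta> are therefore unconditional, while class k is concluded when \<delta> itself lies in
  \<open>Sl k\<close> and can act as the detected state.\<close>

theorem lemma4:
  fixes \<delta> C P W :: "'k::finite two_particle_op"
    and k :: nat
    and \<epsilon> c :: real
  assumes k: "2 \<le> k" "k \<le> CARD('k)"
    and edge: "edge_state k \<delta>"
    and C: "op_on_asym C" "psd C" "Re (trace (\<delta> ** C)) > 0"
    and P: "op_on_asym P" "psd P"
    and range_P: "(\<lambda>\<psi>. P *v \<psi>) ` asym_space = {\<psi> \<in> asym_space. \<delta> *v \<psi> = 0}"
    and eps: "\<epsilon> = (INF \<psi>\<in>{\<psi>. pure_state \<psi> \<and> slater_rank \<psi> < enat k}. Re (cinner \<psi> (P *v \<psi>)))"
    and c: "c = (SUP \<psi>\<in>{\<psi>. pure_state \<psi>}. Re (cinner \<psi> (C *v \<psi>)))"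
    and W: "W = P - (\<epsilon> / c) *\<^sub>R C"
  shows "op_on_asym W \<and> hermitian W \<and>
         (\<forall>\<sigma>\<in>Sl (k - 1). 0 \<le> Re (trace (W ** \<sigma>))) \<and>
         Re (trace (W ** \<delta>)) < 0 \<and>
         (\<delta> \<in> Sl k \<longrightarrow> slater_witness k W)"
proof -
  let ?S = "{\<psi> :: 'k two_particle. pure_state \<psi> \<and> slater_rank \<psi> < enat k}"
  let ?f = "\<lambda>\<psi>. Re (cinner \<psi> (P *v \<psi>))"
  have herm: "hermitian W"
    using P C by (simp add: W hermitian_diff_scaleR psd_def)
  have op: "op_on_asym W"
    using P C by (simp add: W op_on_asym_diff_scaleR)
  have "C \<noteq> 0"
    using C(3) by (auto simp: trace_def matrix_matrix_mult_def)
  then have c_pos: "0 < c"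
    using psd_Sup_expectation_pos C c by blast
  obtain \<phi> where \<phi>: "\<phi> \<in> ?S" "\<And>\<psi>. \<psi> \<in> ?S \<Longrightarrow> ?f \<phi> \<le> ?f \<psi>"
    using continuous_attains_inf[OF compact_slater_rank_less _ continuous_expectation]
      exists_pure_slater_rank_less[OF k(1)] by (metis (no_types, lifting) empty_iff mem_Collect_eq)
  then have eps_eq: "\<epsilon> = ?f \<phi>"
    unfolding eps by (intro cInf_eq_minimum) auto
  have eps_pos: "0 < \<epsilon>"
    using edge_state_no_kernel_vector[OF edge P(2)] range_P \<phi>(1) by (simp add: eps_eq)
  have pure: "0 \<le> Re (cinner \<psi> (W *v \<psi>))" if "\<psi> \<in> ?S" for \<psi>
  proof -
    have "Re (cinner \<psi> (C *v \<psi>)) \<le> c"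
      using expectation_le_Sup that unfolding c by blast
    then have "\<epsilon> / c * Re (cinner \<psi> (C *v \<psi>)) \<le> \<epsilon> / c * c"
      using eps_pos c_pos by (intro mult_left_mono) auto
    also have "\<dots> \<le> ?f \<psi>"
      using \<phi>(2)[OF that] c_pos eps_eq by simp
    finally show ?thesis
      by (simp add: W matrix_vector_mult_diff_rdistrib scaleR_mult_vector cinner_diff_right cinner_scaleR_right)
  qed
  have pos: "0 \<le> Re (trace (W ** \<sigma>))" if \<sigma>: "\<sigma> \<in> Sl (k - 1)" for \<sigma>
  proof -
    obtain n p \<psi> where d: "pure_decomposition \<sigma> n p \<psi>" "\<And>i. i < n \<Longrightarrow> slater_rank (\<psi> i) \<le> enat (k - 1)"
      using Sl_decomposition[OF \<sigma>] by blast
    have S: "\<psi> i \<in> ?S" if "i < n" for i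
    proof -
      have "slater_rank (\<psi> i) < enat k"
        \<comment> \<open>Natural subtraction truncates at 0; k - 1 < k holds because k is at least
          2.\<close>
        by (rule le_less_trans[OF d(2)[OF that]]) (use k in simp)
      then show ?thesis
        using d(1) that by (simp add: pure_decomposition_def)
    qed
    have "trace (W ** \<sigma>) = (\<Sum>i<n. of_real (p i) * cinner (\<psi> i) (W *v \<psi> i))"
      using d(1) by (simp add: pure_decomposition_def trace_mult_sum trace_mult_proj)
    also have "Re \<dots> = (\<Sum>i<n. p i * Re (cinner (\<psi> i) (W *v \<psi> i)))"
      by simp
    also have "\<dots> \<ge> 0"
      using d(1) pure[OF S] by (intro sum_nonneg mult_nonneg_nonneg) (auto simp: pure_decomposition_def less_imp_le)
    finally show ?thesis .
  qed
  have "\<delta> ** P = 0"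
    using range_P by (intro op_on_asym_eq_zero[OF P(1)]) blast
  then have "trace (\<delta> ** W) = - of_real (\<epsilon> / c) * trace (\<delta> ** C)"
  proof -
    \<comment> \<open>W is written as a two-term weighted sum, indexed by truth values, to fit
      \<open>trace_mult_sum\<close>.\<close>
    have "W = (\<Sum>i\<in>{True, False}. (if i then 1 else - (\<epsilon> / c)) *\<^sub>R (if i then P else C))"
      by (simp add: W)
    then have "trace (\<delta> ** W) = trace (\<delta> ** P) - of_real (\<epsilon> / c) * trace (\<delta> ** C)"
      by (simp only: trace_mult_sum) simp
    with \<open>\<delta> ** P = 0\<close> show ?thesis by (simp add: trace_def)
  qed
  then have "Re (trace (W ** \<delta>)) = - (\<epsilon> / c) * Re (trace (\<delta> ** C))"
    by (subst trace_mul_sym) simp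
  then have neg: "Re (trace (W ** \<delta>)) < 0"
    using eps_pos c_pos C(3) by simp
  show ?thesis
    using op herm pos neg k(1) by (auto simp: slater_witness_def)
qed

end
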